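(* Let $P$ be a parallelogram-free pattern with $|P|\geq 3$. Then there is a constant $c=c(P)>0$ such that for all $n\geq|P|$, \[ S_P^{\nparallel}(n)\geq c\,n\log n. \]
   Context: A finite set $A\subseteq\mathbb{C}$ is parallelogram-free if it has no three collinear points and contains no four points that are the vertices of a parallelogram. Sets $A,B$ are similar if $B=zA+w$ for some $z,w\in\mathbb{C}$, $z\neq0$; $S_P(A)$ is the number of subsets of $A$ similar to $P$. For a parallelogram-free pattern $P$, $S_P^{\nparallel}(n)$ is the maximum of $S_P(A)$ over all parallelogram-free sets $A$ with $|A|=n$. *)

theory Defs
  imports "HOL-Analysis.Analysis"
begin

definition no_three_collinear :: "complex set \<Rightarrow> bool" where
  "no_three_collinear A \<longleftrightarrow>
     (\<forall>a\<in>A. \<forall>b\<in>A. \<forall>c\<in>A. a \<noteq> b \<and> b \<noteq> c \<and> a \<noteq> c \<longrightarrow> \<not> collinear {a, b, c})"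

text \<open>The vertices are listed in cyclic order; non-collinearity of three of them makes the
  parallelogram nondegenerate and forces the four vertices to be distinct.\<close>

definition parallelogram :: "complex \<Rightarrow> complex \<Rightarrow> complex \<Rightarrow> complex \<Rightarrow> bool" where
  "parallelogram a b c d \<longleftrightarrow> b - a = c - d \<and> \<not> collinear {a, b, c}"

definition parallelogram_free :: "complex set \<Rightarrow> bool" where
  "parallelogram_free A \<longleftrightarrow> finite A \<and> no_three_collinear A \<and>
     \<not> (\<exists>a\<in>A. \<exists>b\<in>A. \<exists>c\<in>A. \<exists>d\<in>A. parallelogram a b c d)"

definition similar :: "complex set \<Rightarrow> complex set \<Rightarrow> bool" where
  "similar A B \<longleftrightarrow> (\<exists>z w. z \<noteq> 0 \<and> B = (\<lambda>x. z * x + w) ` A)"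

definition similar_copies :: "complex set \<Rightarrow> complex set \<Rightarrow> nat" where
  "similar_copies P A = card {B. B \<subseteq> A \<and> similar P B}"

text \<open>The set of values is finite, since a finite set \<open>A\<close> gives at most \<open>2 ^ card A\<close> copies. It is
  nonempty, since \<open>n\<close> points of a parabola form a parallelogram-free set.\<close>

definition max_similar_copies_pf :: "complex set \<Rightarrow> nat \<Rightarrow> nat" where
  "max_similar_copies_pf P n =
     Max {similar_copies P A | A. parallelogram_free A \<and> card A = n}"

end

theory Submission
  imports Defs
begin

text \<open>Let \<open>k = card P\<close>. Given a parallelogram-free set \<open>A\<close>, replace every \<open>a \<in> A\<close> by the copy
  \<open>a + (z a + w) P\<close>. For fixed \<open>p \<in> P\<close> the points \<open>a + p (z a + w)\<close> form a similar copy of \<open>A\<close>,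
  so the new set has \<open>k card A\<close> points and at least \<open>k S + card A\<close> copies of \<open>P\<close>, where \<open>S\<close> is the
  number of copies in \<open>A\<close>; for generic \<open>z\<close> and \<open>w\<close> it is again parallelogram-free. Iterating from
  a single point yields \<open>k ^ m\<close> points with \<open>m k ^ (m - 1)\<close> copies, and adding generic points reaches
  every intermediate cardinality.\<close>

section \<open>Algebraic form of collinearity and of parallelogram-freeness\<close>

text \<open>This is minus twice the signed area of the triangle. Being a real polynomial in the
  coordinates, it turns collinearity into an equation in the parameters.\<close>

definition cross :: "complex \<Rightarrow> complex \<Rightarrow> complex \<Rightarrow> real" where
  "cross a b c = Im ((b - a) * cnj (c - a))"

lemma real_multiple_iff_Im:
  assumes "u \<noteq> 0"
  shows "(\<exists>r. v = r *\<^sub>R u) \<longleftrightarrow> Im (u * cnj v) = 0"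
proof
  assume "Im (u * cnj v) = 0"
  then have eq: "Im u * Re v = Re u * Im v" by (simp add: algebra_simps)
  show "\<exists>r. v = r *\<^sub>R u"
  proof (cases "Re u = 0")
    case True
    then have "Im u \<noteq> 0" using assms by (auto simp: complex_eq_iff)
    with True eq show ?thesis
      by (intro exI[of _ "Im v / Im u"]) (simp add: complex_eq_iff)
  next
    case False
    with eq show ?thesis
      by (intro exI[of _ "Re v / Re u"]) (simp add: complex_eq_iff field_simps)
  qed
qed auto

lemma collinear_iff_cross: "collinear {a, b, c} \<longleftrightarrow> cross a b c = 0"
proof -
  have "collinear {a, b, c} \<longleftrightarrow> collinear {b, a, c}"
    by (simp add: insert_commute)
  also have "\<dots> \<longleftrightarrow> collinear {0, b - a, c - a}"
    using collinear_3[of b a c] by simp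
  also have "\<dots> \<longleftrightarrow> cross a b c = 0"
  proof (cases "b = a")
    case True
    then show ?thesis by (simp add: cross_def)
  next
    case False
    then have "collinear {0, b - a, c - a} \<longleftrightarrow> (\<exists>r. c - a = r *\<^sub>R (b - a))"
      by (auto simp: collinear_lemma)
    also have "\<dots> \<longleftrightarrow> cross a b c = 0"
      using False unfolding cross_def by (intro real_multiple_iff_Im) simp
    finally show ?thesis .
  qed
  finally show ?thesis .
qed

text \<open>Given that no three points are collinear, a nontrivial solution of
  \<open>a + c = b + d\<close> with \<open>a \<noteq> c\<close> is a genuine parallelogram, while
  \<open>a = c\<close> makes \<open>a\<close> the midpoint of \<open>b\<close> and \<open>d\<close>,
  hence collinear with them. The additive form on the right needs no separate treatment of
  degenerate quadruples.\<close>

lemma parallelogram_free_iff: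
  "parallelogram_free A \<longleftrightarrow> finite A \<and>
     (\<forall>a\<in>A. \<forall>b\<in>A. \<forall>c\<in>A. a \<noteq> b \<and> b \<noteq> c \<and> a \<noteq> c \<longrightarrow> cross a b c \<noteq> 0) \<and>
     (\<forall>a\<in>A. \<forall>b\<in>A. \<forall>c\<in>A. \<forall>d\<in>A. a + c = b + d \<longrightarrow> a = b \<or> a = d)"
  (is "_ \<longleftrightarrow> _ \<and> ?N \<and> ?Q")
proof -
  have N: "no_three_collinear A \<longleftrightarrow> ?N"
    by (simp add: no_three_collinear_def collinear_iff_cross)
  have "\<not> (\<exists>a\<in>A. \<exists>b\<in>A. \<exists>c\<in>A. \<exists>d\<in>A. parallelogram a b c d) \<longleftrightarrow> ?Q" if ?N
  proof
    assume np: "\<not> (\<exists>a\<in>A. \<exists>b\<in>A. \<exists>c\<in>A. \<exists>d\<in>A. parallelogram a b c d)"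
    show ?Q
    proof (intro ballI impI, rule ccontr)
      fix a b c d
      assume A: "a \<in> A" "b \<in> A" "c \<in> A" "d \<in> A" and eq: "a + c = b + d"
        and ne: "\<not> (a = b \<or> a = d)"
      have eq': "b - a = c - d" using eq by (simp add: algebra_simps)
      have bc: "b \<noteq> c" using ne eq by auto
      show False
      proof (cases "a = c")
        case True
        have d: "d = 2 * a - b" using eq True by (simp add: algebra_simps)
        have "b \<noteq> d" using d ne by auto
        moreover have "cross a b d = 0"
          unfolding d cross_def by (simp add: algebra_simps)
        ultimately show False using that A ne by metis
      next
        case False
        then have "cross a b c \<noteq> 0" using that A ne bc by blast
        then have "parallelogram a b c d"
          using eq' by (simp add: parallelogram_def collinear_iff_cross)
        with np A show False by blast
      qed
    qed
  next
    assume Q: ?Q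
    show "\<not> (\<exists>a\<in>A. \<exists>b\<in>A. \<exists>c\<in>A. \<exists>d\<in>A. parallelogram a b c d)"
    proof (intro notI, elim bexE)
      fix a b c d
      assume A: "a \<in> A" "b \<in> A" "c \<in> A" "d \<in> A" and p: "parallelogram a b c d"
      from p have eq: "b - a = c - d" and nc: "cross a b c \<noteq> 0"
        by (auto simp: parallelogram_def collinear_iff_cross)
      have "a + c = b + d" using eq by (simp add: algebra_simps)
      with Q A have "a = b \<or> a = d" by blast
      then show False using eq nc by (auto simp: cross_def algebra_simps)
    qed
  qed
  then show ?thesis unfolding parallelogram_free_def N by blast
qed

section \<open>Finiteness of bad parameters on a parabola\<close>

text \<open>Generic points are taken on a parabola: it meets every line and every circle in finitely
  many points, so only finitely many parameters have to be avoided.\<close>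

definition par :: "real \<Rightarrow> complex" where
  "par t = Complex t (t\<^sup>2)"

lemma finite_par_generic:
  assumes "c \<noteq> 0 \<or> k \<noteq> 0 \<or> d \<noteq> 0"
  shows "finite {t. c + Im (k * par t) + d * (cmod (par t))\<^sup>2 = 0}"
proof -
  \<comment> \<open>The top coefficient isolates \<open>d\<close>, after which the quadratic one
    isolates \<open>Re k\<close>; so \<open>q = 0\<close> would force \<open>c\<close>,
    \<open>k\<close> and \<open>d\<close> all to vanish.\<close>
  define q where "q = [: c, Im k, Re k + d, 0, d :]"
  have "q \<noteq> 0" using assms by (auto simp: q_def complex_eq_iff)
  then have "finite {t. poly q t = 0}" by (rule poly_roots_finite)
  moreover have "poly q t = c + Im (k * par t) + d * (cmod (par t))\<^sup>2" for t
    unfolding q_def cmod_power2 par_def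
    by (simp add: algebra_simps power2_eq_square)
  ultimately show ?thesis by simp
qed

lemma finite_par_affine:
  assumes "k \<noteq> 0"
  shows "finite {t. b + k * par t = 0}"
proof (rule finite_subset)
  show "finite {t. Im b + Im (k * par t) + 0 * (cmod (par t))\<^sup>2 = 0}"
    using assms by (intro finite_par_generic) auto
  show "{t. b + k * par t = 0} \<subseteq> {t. Im b + Im (k * par t) + 0 * (cmod (par t))\<^sup>2 = 0}"
    by (auto simp: complex_eq_iff)
qed

text \<open>The area of a triangle whose vertices depend affinely on a complex parameter is a
  constant plus a real-linear term plus a multiple of the squared modulus. The three disjuncts say
  that one of these coefficients is nonzero.\<close>

lemma finite_par_cross:
  assumes "cross a b c \<noteq> 0 \<or> (q - p) * cnj (c - a) - cnj (b - a) * (r - p) \<noteq> 0 \<or> cross p q r \<noteq> 0"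
  shows "finite {t. cross (a + p * par t) (b + q * par t) (c + r * par t) = 0}"
proof -
  \<comment> \<open>The mixed term containing \<open>cnj w\<close> is rewritten by
    \<open>Im (cnj u) = - Im u\<close>, which produces the minus sign in the linear
    coefficient.\<close>
  have *: "Im ((\<alpha> + \<beta> * w) * cnj (\<gamma> + \<delta> * w)) =
      Im (\<alpha> * cnj \<gamma>) + Im ((\<beta> * cnj \<gamma> - cnj \<alpha> * \<delta>) * w) + Im (\<beta> * cnj \<delta>) * (cmod w)\<^sup>2"
    for \<alpha> \<beta> \<gamma> \<delta> w
    unfolding cmod_power2 by (simp add: algebra_simps power2_eq_square)
  have "(b + q * w) - (a + p * w) = (b - a) + (q - p) * w"
    "(c + r * w) - (a + p * w) = (c - a) + (r - p) * w" for w
    by (simp_all add: algebra_simps)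
  then have "cross (a + p * w) (b + q * w) (c + r * w) =
      cross a b c + Im (((q - p) * cnj (c - a) - cnj (b - a) * (r - p)) * w)
        + cross p q r * (cmod w)\<^sup>2" for w
    unfolding cross_def by (simp only: *)
  then show ?thesis using finite_par_generic[OF assms] by simp
qed

section \<open>Enlarging parallelogram-free sets\<close>

lemma parallelogram_free_insert:
  assumes "parallelogram_free A"
  obtains x where "x \<notin> A" "parallelogram_free (insert x A)"
proof -
  have fin: "finite A"
    and N: "\<And>a b c. a \<in> A \<Longrightarrow> b \<in> A \<Longrightarrow> c \<in> A \<Longrightarrow> a \<noteq> b \<Longrightarrow> b \<noteq> c \<Longrightarrow> a \<noteq> c \<Longrightarrow> cross a b c \<noteq> 0"
    and Q: "\<And>a b c d. a \<in> A \<Longrightarrow> b \<in> A \<Longrightarrow> c \<in> A \<Longrightarrow> d \<in> A \<Longrightarrow> a + c = b + d \<Longrightarrow> a = b \<or> a = d"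
    using assms unfolding parallelogram_free_iff by blast+
  \<comment> \<open>The four sets collect the parameters where the new point lies in
    \<open>A\<close>, on a line through two points of \<open>A\<close>, at a fourth vertex
    \<open>b + c - a\<close>, or at a midpoint of points of \<open>A\<close>.\<close>
  define S1 where "S1 = (\<Union>a\<in>A. {t. - a + 1 * par t = 0})"
  define S2 where "S2 = (\<Union>(a, b)\<in>{(a, b)\<in>A \<times> A. a \<noteq> b}.
    {t. cross (0 + 1 * par t) (a + 0 * par t) (b + 0 * par t) = 0})"
  define S3 where "S3 = (\<Union>(a, b, c)\<in>A \<times> A \<times> A. {t. (a - b - c) + 1 * par t = 0})"
  define S4 where "S4 = (\<Union>(a, b)\<in>A \<times> A. {t. (- a - b) + 2 * par t = 0})"
  have f1: "finite S1" unfolding S1_def using fin by (intro finite_UN_I finite_par_affine) auto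
  have f2: "finite S2" unfolding S2_def
  proof (intro finite_UN_I)
    show "finite {(a, b)\<in>A \<times> A. a \<noteq> b}"
      by (rule finite_subset[of _ "A \<times> A"]) (use fin in auto)
    fix x assume "x \<in> {(a, b)\<in>A \<times> A. a \<noteq> b}"
    then obtain a b where x: "x = (a, b)" "a \<noteq> b" by auto
    have "(0 - 1) * cnj (b - 0) - cnj (a - 0) * (0 - 1) = cnj (a - b)"
      by simp
    then have "(0 - 1) * cnj (b - 0) - cnj (a - 0) * (0 - 1) \<noteq> 0" using x by simp
    then show "finite (case x of (a, b) \<Rightarrow>
       {t. cross (0 + 1 * par t) (a + 0 * par t) (b + 0 * par t) = 0})"
      unfolding x prod.case by (intro finite_par_cross) blast
  qed
  have f3: "finite S3" unfolding S3_def using fin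
    by (intro finite_UN_I) (auto intro!: finite_par_affine[where k = 1, simplified])
  have f4: "finite S4" unfolding S4_def using fin
    by (intro finite_UN_I) (auto intro!: finite_par_affine)
  obtain t where t: "t \<notin> S1 \<union> S2 \<union> S3 \<union> S4"
    using ex_new_if_finite[OF infinite_UNIV_char_0] f1 f2 f3 f4 by (metis finite_UnI)
  define x where "x = par t"
  have x1: "x \<notin> A" using t unfolding S1_def x_def by auto
  have x2: "cross x a b \<noteq> 0" if "a \<in> A" "b \<in> A" "a \<noteq> b" for a b
    using t that unfolding S2_def x_def by auto
  have x3: "x \<noteq> b + c - a" if "a \<in> A" "b \<in> A" "c \<in> A" for a b c
    using t that unfolding S3_def x_def by (force simp: algebra_simps)
  have x4: "x + x \<noteq> a + b" if "a \<in> A" "b \<in> A" for a b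
    using t that unfolding S4_def x_def by (force simp: algebra_simps)
  have cyc: "cross a b c = cross b c a" for a b c
    unfolding cross_def by (simp add: algebra_simps)
  have "parallelogram_free (insert x A)"
    unfolding parallelogram_free_iff
  proof (intro conjI ballI impI)
    show "finite (insert x A)" using fin by simp
  next
    fix a b c assume "a \<in> insert x A" "b \<in> insert x A" "c \<in> insert x A"
      and "a \<noteq> b \<and> b \<noteq> c \<and> a \<noteq> c"
    then show "cross a b c \<noteq> 0"
      using N[of a b c] x2[of b c] x2[of c a] x2[of a b] cyc[of a b c] cyc[of b c a] by auto
  next
    fix a b c d assume A: "a \<in> insert x A" "b \<in> insert x A" "c \<in> insert x A" "d \<in> insert x A"
      and eq: "a + c = b + d"
    show "a = b \<or> a = d"
    proof (rule ccontr)
      assume ne: "\<not> (a = b \<or> a = d)"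
      then have ne': "c \<noteq> b" "c \<noteq> d" using eq by auto
      have e: "a = b + d - c" "b = a + c - d" "c = b + d - a" "d = a + c - b"
        using eq by (simp_all add: algebra_simps)
      \<comment> \<open>The new point can occur twice only at opposite vertices,
        \<open>a = c\<close> or \<open>b = d\<close>, which \<open>x4\<close> excludes; a single
        occurrence is excluded by \<open>x3\<close>.\<close>
      consider "a \<in> A" "b \<in> A" "c \<in> A" "d \<in> A" | "a = x" | "c = x" "a \<noteq> x"
        | "b = x" "a \<noteq> x" "c \<noteq> x" | "d = x" "a \<noteq> x" "b \<noteq> x" "c \<noteq> x"
        using A by auto
      then show False
      proof cases
        case 1 then show False using Q[of a b c d] eq ne by blast
      next
        case 2
        then have "b \<in> A" "d \<in> A" using ne A by auto
        then show False using 2 x3[of c b d] x4[of b d] e(1) eq A(3) by (metis insertE)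
      next
        case 3
        then have "b \<in> A" "d \<in> A" using ne' A by auto
        then show False using 3 x3[of a b d] e(3) A(1) by (metis insertE)
      next
        case 4
        then have "a \<in> A" "c \<in> A" using A by auto
        then show False using 4 x3[of d a c] x4[of a c] e(2) eq A(4) by (metis insertE)
      next
        case 5
        then have "a \<in> A" "c \<in> A" "b \<in> A" using A by auto
        then show False using 5 x3[of b a c] e(4) by metis
      qed
    qed
  qed
  with x1 show ?thesis by (rule that)
qed

lemma parallelogram_free_extend:
  assumes "parallelogram_free A" "card A \<le> n"
  obtains B where "A \<subseteq> B" "parallelogram_free B" "card B = n"
proof -
  have "\<exists>B. A \<subseteq> B \<and> parallelogram_free B \<and> card B = n"
    using assms(2)
  proof (induction n rule: dec_induct)
    case base
    then show ?case using assms(1) by blast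
  next
    case (step n)
    then obtain B where B: "A \<subseteq> B" "parallelogram_free B" "card B = n" by blast
    obtain x where x: "x \<notin> B" "parallelogram_free (insert x B)"
      using parallelogram_free_insert[OF B(2)] .
    have "finite B" using B(2) by (simp add: parallelogram_free_def)
    then show ?case using B x by (intro exI[of _ "insert x B"]) auto
  qed
  then show ?thesis using that by blast
qed

section \<open>Basic properties of the number of similar copies\<close>

lemma finite_copies: "finite A \<Longrightarrow> finite {B. B \<subseteq> A \<and> similar P B}"
  by (rule finite_subset[of _ "Pow A"]) auto

lemma similar_copies_mono:
  assumes "A \<subseteq> B" "finite B"
  shows "similar_copies P A \<le> similar_copies P B"
  unfolding similar_copies_def
  using assms by (intro card_mono finite_copies) auto

lemma max_similar_copies_pf_ge:
  assumes "parallelogram_free A" "card A = n"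
  shows "similar_copies P A \<le> max_similar_copies_pf P n"
  unfolding max_similar_copies_pf_def
proof (rule Max_ge)
  have "similar_copies P A \<le> 2 ^ n" if "parallelogram_free A" "card A = n" for A
  proof -
    have "finite A" using that by (simp add: parallelogram_free_def)
    then have "similar_copies P A \<le> card (Pow A)"
      unfolding similar_copies_def by (intro card_mono) auto
    then show ?thesis using \<open>finite A\<close> that by (simp add: card_Pow)
  qed
  then show "finite {similar_copies P A |A. parallelogram_free A \<and> card A = n}"
    by (auto intro: finite_subset[of _ "{..2 ^ n}"])
qed (use assms in blast)

lemma similar_image:
  assumes "similar P B" "u \<noteq> 0"
  shows "similar P ((\<lambda>x. u * x + v) ` B)"
proof -
  obtain z w where "z \<noteq> 0" "B = (\<lambda>x. z * x + w) ` P"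
    using assms(1) unfolding similar_def by blast
  then have "u * z \<noteq> 0 \<and> (\<lambda>x. u * x + v) ` B = (\<lambda>x. (u * z) * x + (u * w + v)) ` P"
    using assms(2) by (simp add: image_image algebra_simps)
  then show ?thesis unfolding similar_def by blast
qed

section \<open>The product construction and its count of copies\<close>

text \<open>For fixed \<open>a\<close> the points \<open>spread z w p a\<close>, \<open>p \<in> P\<close>, form a copy of \<open>P\<close> with scale \<open>z a + w\<close>;
  for fixed \<open>p\<close> the map \<open>spread z w p\<close> is a similarity with scale \<open>1 + p z\<close>.\<close>

definition spread :: "complex \<Rightarrow> complex \<Rightarrow> complex \<Rightarrow> complex \<Rightarrow> complex" where
  "spread z w p a = a + p * (z * a + w)"

text \<open>Each old copy reappears once in each of the \<open>card P\<close> slices with fixed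
  \<open>p\<close>, and each \<open>a\<close> contributes one new copy. An old copy stays inside one
  slice, whereas a new one meets every slice; as there are at least two slices, the two families are
  disjoint.\<close>

lemma similar_copies_spread:
  assumes fin: "finite P" "finite A" and k: "card P \<ge> 2"
    and nz: "\<And>p. p \<in> P \<Longrightarrow> 1 + p * z \<noteq> 0" "\<And>a. a \<in> A \<Longrightarrow> z * a + w \<noteq> 0"
    and inj: "inj_on (\<lambda>(p, a). spread z w p a) (P \<times> A)"
  shows "card P * similar_copies P A + card A
    \<le> similar_copies P ((\<lambda>(p, a). spread z w p a) ` (P \<times> A))"
proof -
  let ?A' = "(\<lambda>(p, a). spread z w p a) ` (P \<times> A)"
  define C where "C = {B. B \<subseteq> A \<and> similar P B}"
  define g where "g = (\<lambda>(p, B). spread z w p ` B)"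
  define h where "h = (\<lambda>a. (\<lambda>p. spread z w p a) ` P)"
  have inj': "p = q \<and> a = b"
    if "spread z w p a = spread z w q b" "p \<in> P" "q \<in> P" "a \<in> A" "b \<in> A" for p q a b
    using inj_onD[OF inj, of "(p, a)" "(q, b)"] that by auto
  obtain p0 p1 where p01: "p0 \<in> P" "p1 \<in> P" "p0 \<noteq> p1"
    using k by (metis card_le_Suc0_iff_eq fin(1) not_less_eq_eq numeral_2_eq_2)
  \<comment> \<open>A point of the copy is needed to recover the slice \<open>p\<close> from the
    image of the copy.\<close>
  have Cne: "B \<noteq> {}" if "B \<in> C" for B
    using that p01 unfolding C_def similar_def by auto
  have gC: "g ` (P \<times> C) \<subseteq> {B. B \<subseteq> ?A' \<and> similar P B}"
  proof clarify
    fix p B assume "p \<in> P" "B \<in> C"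
    moreover have "spread z w p = (\<lambda>x. (1 + p * z) * x + p * w)"
      by (auto simp: spread_def algebra_simps)
    ultimately show "g (p, B) \<subseteq> ?A' \<and> similar P (g (p, B))"
      using similar_image[of P B "1 + p * z" "p * w"] nz(1)
      unfolding g_def C_def by force
  qed
  have hC: "h ` A \<subseteq> {B. B \<subseteq> ?A' \<and> similar P B}"
  proof clarify
    fix a assume a: "a \<in> A"
    have "z * a + w \<noteq> 0 \<and> h a = (\<lambda>x. (z * a + w) * x + a) ` P"
      using nz(2)[OF a] by (simp add: h_def spread_def algebra_simps)
    then have "similar P (h a)" unfolding similar_def by blast
    then show "h a \<subseteq> ?A' \<and> similar P (h a)" using a by (auto simp: h_def)
  qed
  have injg: "inj_on g (P \<times> C)"
  proof (rule inj_onI, clarify)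
    fix p B q D assume as: "p \<in> P" "B \<in> C" "q \<in> P" "D \<in> C" "g (p, B) = g (q, D)"
    have sub: "B \<subseteq> A" "D \<subseteq> A" using as by (auto simp: C_def)
    have eq: "spread z w p ` B = spread z w q ` D" using as by (simp add: g_def)
    obtain b where b: "b \<in> B" using Cne as by blast
    then obtain d where d: "d \<in> D" "spread z w p b = spread z w q d" using eq by blast
    then have pq: "p = q" using inj' as sub b by blast
    have "inj_on (spread z w p) A" using inj' as by (auto intro!: inj_onI)
    then have "B = D" using eq sub unfolding pq by (simp add: inj_on_image_eq_iff)
    with pq show "p = q \<and> B = D" by simp
  qed
  have injh: "inj_on h A"
  proof (rule inj_onI)
    fix a b assume as: "a \<in> A" "b \<in> A" "h a = h b"
    then have "spread z w p0 a \<in> h b" using p01 unfolding h_def by blast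
    then show "a = b" using inj' as p01 unfolding h_def by blast
  qed
  have disj: "g ` (P \<times> C) \<inter> h ` A = {}"
  proof (rule ccontr)
    assume "g ` (P \<times> C) \<inter> h ` A \<noteq> {}"
    then obtain p B a where as: "p \<in> P" "B \<in> C" "a \<in> A" "g (p, B) = h a" by auto
    have sub: "B \<subseteq> A" using as by (auto simp: C_def)
    have "q = p" if "q \<in> P" for q
    proof -
      have "spread z w q a \<in> spread z w p ` B" using as that unfolding g_def h_def by auto
      then show ?thesis using inj' as sub that by blast
    qed
    then show False using p01 by metis
  qed
  have "finite C" using finite_copies[OF fin(2)] by (simp add: C_def)
  then have "card (g ` (P \<times> C) \<union> h ` A) = card P * card C + card A"
    using fin disj by (subst card_Un_disjoint)
      (auto simp: card_image[OF injg] card_image[OF injh] card_cartesian_product)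
  moreover have "card (g ` (P \<times> C) \<union> h ` A) \<le> similar_copies P ?A'"
    unfolding similar_copies_def using gC hC fin
    by (intro card_mono finite_copies) auto
  ultimately show ?thesis by (simp add: similar_copies_def C_def)
qed

section \<open>Generic parameters for the product construction\<close>

lemma finite_affine_zeros:
  assumes "b \<noteq> 0 \<or> (k :: complex) \<noteq> 0"
  shows "finite {z. b + k * z = 0}"
proof -
  have "[:b, k:] \<noteq> 0" using assms by auto
  from poly_roots_finite[OF this] show ?thesis by (simp add: mult.commute)
qed

text \<open>First \<open>z\<close> is chosen off finitely many bad values, then \<open>w\<close> on the parabola. The coefficient
  \<open>p1 a1 - p2 a2 + p3 a3 - p4 a4\<close> excludes the potential parallelograms with
  \<open>a1 = a2\<close>, \<open>a3 = a4\<close>, \<open>p1 = p4\<close>, \<open>p2 = p3\<close>, where it factors as \<open>(p1 - p2) (a1 - a3)\<close>.\<close>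

lemma spread_generic:
  assumes P: "parallelogram_free P" and A: "parallelogram_free A"
  obtains z w where "\<And>p. p \<in> P \<Longrightarrow> 1 + p * z \<noteq> 0" "\<And>a. a \<in> A \<Longrightarrow> z * a + w \<noteq> 0"
    "inj_on (\<lambda>(p, a). spread z w p a) (P \<times> A)"
    "parallelogram_free ((\<lambda>(p, a). spread z w p a) ` (P \<times> A))"
proof -
  have finP: "finite P"
    and NP: "\<And>a b c. a \<in> P \<Longrightarrow> b \<in> P \<Longrightarrow> c \<in> P \<Longrightarrow> a \<noteq> b \<Longrightarrow> b \<noteq> c \<Longrightarrow> a \<noteq> c \<Longrightarrow> cross a b c \<noteq> 0"
    and QP: "\<And>a b c d. a \<in> P \<Longrightarrow> b \<in> P \<Longrightarrow> c \<in> P \<Longrightarrow> d \<in> P \<Longrightarrow> a + c = b + d \<Longrightarrow> a = b \<or> a = d"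
    using P unfolding parallelogram_free_iff by blast+
  have finA: "finite A"
    and NA: "\<And>a b c. a \<in> A \<Longrightarrow> b \<in> A \<Longrightarrow> c \<in> A \<Longrightarrow> a \<noteq> b \<Longrightarrow> b \<noteq> c \<Longrightarrow> a \<noteq> c \<Longrightarrow> cross a b c \<noteq> 0"
    and QA: "\<And>a b c d. a \<in> A \<Longrightarrow> b \<in> A \<Longrightarrow> c \<in> A \<Longrightarrow> d \<in> A \<Longrightarrow> a + c = b + d \<Longrightarrow> a = b \<or> a = d"
    using A unfolding parallelogram_free_iff by blast+
  define I where "I = P \<times> A"
  have finI: "finite I" using finP finA by (simp add: I_def)
  \<comment> \<open>These are the label quadruples for which the additive criterion forbids a
    relation between the image points.\<close>
  define Q4 where "Q4 = {(x1, x2, x3, x4) \<in> I \<times> I \<times> I \<times> I. x1 \<noteq> x2 \<and> x1 \<noteq> x4}"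
  have finQ4: "finite Q4"
    by (rule finite_subset[of _ "I \<times> I \<times> I \<times> I"]) (use finI in \<open>auto simp: Q4_def\<close>)
  define Z1 where "Z1 = (\<Union>p\<in>P. {z. 1 + p * z = 0})"
  \<comment> \<open>When \<open>p1 + p3 = p2 + p4\<close>, the parameter \<open>w\<close> cancels
    from the relation between the four image points, so only the choice of \<open>z\<close> can
    exclude it.\<close>
  define Z2 where "Z2 = (\<Union>((p1, a1), (p2, a2), (p3, a3), (p4, a4)) \<in>
      {((p1, a1), (p2, a2), (p3, a3), (p4, a4)) \<in> Q4. p1 + p3 = p2 + p4}.
    {z. (a1 - a2 + a3 - a4) + (p1 * a1 - p2 * a2 + p3 * a3 - p4 * a4) * z = 0})"
  have fZ1: "finite Z1" unfolding Z1_def using finP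
    by (intro finite_UN_I finite_affine_zeros) auto
  have fZ2: "finite Z2" unfolding Z2_def
  proof (intro finite_UN_I, goal_cases)
    case 1
    show ?case by (rule finite_subset[OF _ finQ4]) auto
  next
    case (2 x)
    then obtain p1 a1 p2 a2 p3 a3 p4 a4 where x: "x = ((p1, a1), (p2, a2), (p3, a3), (p4, a4))"
      and xQ: "((p1, a1), (p2, a2), (p3, a3), (p4, a4)) \<in> Q4" and pe: "p1 + p3 = p2 + p4"
      by auto
    have mem: "p1 \<in> P" "p2 \<in> P" "p3 \<in> P" "p4 \<in> P" "a1 \<in> A" "a2 \<in> A" "a3 \<in> A" "a4 \<in> A"
      and ne: "\<not> (p1 = p2 \<and> a1 = a2)" "\<not> (p1 = p4 \<and> a1 = a4)"
      using xQ by (auto simp: Q4_def I_def)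
    have "a1 - a2 + a3 - a4 \<noteq> 0 \<or> p1 * a1 - p2 * a2 + p3 * a3 - p4 * a4 \<noteq> 0"
    proof (rule ccontr)
      assume "\<not> ?thesis"
      then have e1: "a1 + a3 = a2 + a4" and e2: "p1 * a1 - p2 * a2 + p3 * a3 - p4 * a4 = 0"
        by (auto simp: algebra_simps)
      \<comment> \<open>Both coordinates satisfy a trivial additive relation. As the first label
        differs from the second and the fourth, the two coordinates must pair up in opposite
        ways.\<close>
      have "p1 = p2 \<or> p1 = p4" "a1 = a2 \<or> a1 = a4"
        using QP QA mem pe e1 by blast+
      then consider "p1 = p2" "a1 = a4" "p1 \<noteq> p4" "a1 \<noteq> a2" | "p1 = p4" "a1 = a2" "p1 \<noteq> p2" "a1 \<noteq> a4"
        using ne by blast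
      then show False
      proof cases
        case 1
        then have "p3 = p4" "a3 = a2" using pe e1 by auto
        with 1 e2 have "(p1 - p4) * (a1 - a2) = 0" by (simp add: algebra_simps)
        with 1 show False by simp
      next
        case 2
        then have "p3 = p2" "a3 = a4" using pe e1 by auto
        with 2 e2 have "(p1 - p2) * (a1 - a4) = 0" by (simp add: algebra_simps)
        with 2 show False by simp
      qed
    qed
    then show ?case unfolding x prod.case by (rule finite_affine_zeros)
  qed
  obtain z where z: "z \<notin> Z1 \<union> Z2"
    using ex_new_if_finite[OF infinite_UNIV_char_0] fZ1 fZ2 by (metis finite_UnI)
  have z1: "1 + p * z \<noteq> 0" if "p \<in> P" for p
    using z that unfolding Z1_def by auto
  \<comment> \<open>This is the part of \<open>spread\<close> free of \<open>w\<close>: once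
    \<open>z\<close> is fixed, every image point is affine in \<open>w\<close> with slope
    \<open>p\<close>.\<close>
  define e where "e = (\<lambda>(p, a). (1 + p * z) * a)"
  have sp: "(\<lambda>(p, a). spread z w p a) = (\<lambda>x. e x + fst x * w)" for w
    by (auto simp: spread_def e_def algebra_simps fun_eq_iff)
  have z2: "e x1 - e x2 + e x3 - e x4 \<noteq> 0 \<or> fst x1 - fst x2 + fst x3 - fst x4 \<noteq> 0"
    if "(x1, x2, x3, x4) \<in> Q4" for x1 x2 x3 x4
  proof (rule ccontr)
    assume c: "\<not> ?thesis"
    obtain p1 a1 p2 a2 p3 a3 p4 a4 where x: "x1 = (p1, a1)" "x2 = (p2, a2)" "x3 = (p3, a3)" "x4 = (p4, a4)"
      by (metis surj_pair)
    from c x have "p1 + p3 = p2 + p4" by (simp add: algebra_simps)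
    moreover have "(a1 - a2 + a3 - a4) + (p1 * a1 - p2 * a2 + p3 * a3 - p4 * a4) * z = 0"
      using c x by (simp add: e_def algebra_simps)
    ultimately have "z \<in> Z2" using that unfolding Z2_def x
      by (intro UN_I[of "((p1, a1), (p2, a2), (p3, a3), (p4, a4))"]) auto
    with z show False by blast
  qed
  define T1 where "T1 = (\<Union>a\<in>A. {t. z * a + 1 * par t = 0})"
  define T2 where "T2 = (\<Union>(x, y)\<in>{(x, y) \<in> I \<times> I. x \<noteq> y}. {t. (e x - e y) + (fst x - fst y) * par t = 0})"
  define T3 where "T3 = (\<Union>(x1, x2, x3, x4)\<in>Q4.
     {t. (e x1 - e x2 + e x3 - e x4) + (fst x1 - fst x2 + fst x3 - fst x4) * par t = 0})"
  define T4 where "T4 = (\<Union>(x, y, v)\<in>{(x, y, v) \<in> I \<times> I \<times> I. x \<noteq> y \<and> y \<noteq> v \<and> x \<noteq> v}.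
     {t. cross (e x + fst x * par t) (e y + fst y * par t) (e v + fst v * par t) = 0})"
  have aff: "finite {t. b + k * par t = 0}" if "b \<noteq> 0 \<or> k \<noteq> 0" for b k
    using that finite_par_affine[of k b] by (cases "k = 0") auto
  have eI: "e x \<noteq> e y" if "x \<in> I" "y \<in> I" "x \<noteq> y" "fst x = fst y" for x y
    using that z1 by (auto simp: e_def I_def)
  have f1: "finite T1" unfolding T1_def using finA by (intro finite_UN_I aff) auto
  have f2: "finite T2" unfolding T2_def
  proof (intro finite_UN_I, goal_cases)
    case 1
    show ?case by (rule finite_subset[of _ "I \<times> I"]) (use finI in auto)
  next
    case (2 xy)
    then obtain x y where "xy = (x, y)" "x \<in> I" "y \<in> I" "x \<noteq> y" by auto
    then show ?case using eI[of x y] by (auto intro!: aff)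
  qed
  have f3: "finite T3" unfolding T3_def
  proof (intro finite_UN_I[OF finQ4], goal_cases)
    case (1 x)
    obtain x1 x2 x3 x4 where x: "x = (x1, x2, x3, x4)" by (metis surj_pair)
    show ?case using z2[OF 1[unfolded x]] unfolding x prod.case by (rule aff)
  qed
  have f4: "finite T4" unfolding T4_def
  proof (intro finite_UN_I, goal_cases)
    case 1
    show ?case by (rule finite_subset[of _ "I \<times> I \<times> I"]) (use finI in auto)
  next
    case (2 xyv)
    then obtain x y v where xyv: "xyv = (x, y, v)" and I: "x \<in> I" "y \<in> I" "v \<in> I"
      and ne: "x \<noteq> y" "y \<noteq> v" "x \<noteq> v" by blast
    have mem: "fst x \<in> P" "fst y \<in> P" "fst v \<in> P" "snd x \<in> A" "snd y \<in> A" "snd v \<in> A"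
      using I by (auto simp: I_def)
    \<comment> \<open>The nonzero coefficient depends on the slices: with three different slices it
      is the quadratic one, as \<open>P\<close> has no collinear triple; with a single slice the
      constant one, a rescaled area from \<open>A\<close>; with exactly two slices the linear
      one.\<close>
    have "cross (e x) (e y) (e v) \<noteq> 0
      \<or> (fst y - fst x) * cnj (e v - e x) - cnj (e y - e x) * (fst v - fst x) \<noteq> 0
      \<or> cross (fst x) (fst y) (fst v) \<noteq> 0" (is "?c \<or> ?k \<or> ?d")
    proof -
      consider "fst x \<noteq> fst y" "fst y \<noteq> fst v" "fst x \<noteq> fst v"
        | "fst x = fst y" "fst y = fst v" | "fst x = fst y" "fst y \<noteq> fst v"
        | "fst x = fst v" "fst y \<noteq> fst v" | "fst y = fst v" "fst x \<noteq> fst v" by metis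
      then show ?thesis
      proof cases
        case 1
        then show ?thesis using NP mem by blast
      next
        case 2
        define u where "u = 1 + fst x * z"
        have u: "u \<noteq> 0" using z1 mem by (simp add: u_def)
        have "e x = u * snd x" "e y = u * snd y" "e v = u * snd v"
          using 2 by (auto simp: e_def u_def case_prod_beta)
        then have "cross (e x) (e y) (e v) = Im ((u * cnj u) * ((snd y - snd x) * cnj (snd v - snd x)))"
          by (simp add: cross_def algebra_simps)
        also have "\<dots> = (cmod u)\<^sup>2 * cross (snd x) (snd y) (snd v)"
          unfolding complex_norm_square[symmetric] cross_def by simp
        finally have "cross (e x) (e y) (e v) = (cmod u)\<^sup>2 * cross (snd x) (snd y) (snd v)" .
        moreover have "cross (snd x) (snd y) (snd v) \<noteq> 0"
          using NA mem ne 2 by (metis prod.expand)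
        ultimately show ?thesis using u by simp
      next
        case 3
        then have "e x \<noteq> e y" using eI I ne by blast
        with 3 have ?k by (simp flip: complex_cnj_diff)
        then show ?thesis by blast
      next
        case 4
        then have "e x \<noteq> e v" using eI I ne by blast
        with 4 have ?k by (simp flip: complex_cnj_diff)
        then show ?thesis by blast
      next
        case 5
        then have "e y \<noteq> e v" using eI I ne by blast
        moreover have "(fst y - fst x) * cnj (e v - e x) - cnj (e y - e x) * (fst v - fst x)
          = (fst v - fst x) * cnj (e v - e y)" using 5 by (simp add: algebra_simps)
        ultimately have ?k using 5 by (simp flip: complex_cnj_diff)
        then show ?thesis by blast
      qed
    qed
    then show ?case unfolding xyv prod.case by (rule finite_par_cross)
  qed
  obtain t where t: "t \<notin> T1 \<union> T2 \<union> T3 \<union> T4"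
    using ex_new_if_finite[OF infinite_UNIV_char_0] f1 f2 f3 f4 by (metis finite_UnI)
  define w where "w = par t"
  define F where "F x = e x + fst x * w" for x
  have Fsp: "(\<lambda>(p, a). spread z w p a) = F" unfolding sp F_def ..
  have t1: "z * a + w \<noteq> 0" if "a \<in> A" for a
    using t that unfolding T1_def w_def by auto
  have injF: "inj_on F I"
  proof (rule inj_onI, rule ccontr)
    fix x y assume "x \<in> I" "y \<in> I" "F x = F y" "x \<noteq> y"
    moreover from this have "(e x - e y) + (fst x - fst y) * w = 0"
      by (simp add: F_def algebra_simps)
    ultimately have "t \<in> T2" unfolding T2_def w_def by (intro UN_I[of "(x, y)"]) auto
    with t show False by blast
  qed
  have "parallelogram_free (F ` I)"
    unfolding parallelogram_free_iff
  proof (intro conjI ballI impI)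
    show "finite (F ` I)" using finI by simp
  next
    fix a b c assume "a \<in> F ` I" "b \<in> F ` I" "c \<in> F ` I" and ne: "a \<noteq> b \<and> b \<noteq> c \<and> a \<noteq> c"
    then obtain x y v where x: "a = F x" "b = F y" "c = F v" "x \<in> I" "y \<in> I" "v \<in> I" by auto
    then have "x \<noteq> y" "y \<noteq> v" "x \<noteq> v" using ne by auto
    show "cross a b c \<noteq> 0"
    proof
      assume "cross a b c = 0"
      then have "t \<in> T4" using x \<open>x \<noteq> y\<close> \<open>y \<noteq> v\<close> \<open>x \<noteq> v\<close>
        unfolding T4_def by (intro UN_I[of "(x, y, v)"]) (auto simp: F_def w_def)
      with t show False by blast
    qed
  next
    fix a b c d assume "a \<in> F ` I" "b \<in> F ` I" "c \<in> F ` I" "d \<in> F ` I" and eq: "a + c = b + d"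
    then obtain x1 x2 x3 x4 where x: "a = F x1" "b = F x2" "c = F x3" "d = F x4"
      "x1 \<in> I" "x2 \<in> I" "x3 \<in> I" "x4 \<in> I" by auto
    show "a = b \<or> a = d"
    proof (rule ccontr)
      assume "\<not> (a = b \<or> a = d)"
      then have "(x1, x2, x3, x4) \<in> Q4" using x by (auto simp: Q4_def)
      moreover have "(e x1 - e x2 + e x3 - e x4) + (fst x1 - fst x2 + fst x3 - fst x4) * w = 0"
        using eq unfolding x F_def by (simp add: algebra_simps)
      ultimately have "t \<in> T3" unfolding T3_def w_def by (intro UN_I[of "(x1, x2, x3, x4)"]) auto
      with t show False by blast
    qed
  qed
  with injF z1 t1 show ?thesis using that[of z w] unfolding Fsp I_def by blast
qed

section \<open>Iteration and the final estimate\<close>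

text \<open>By the recurrence \<open>S' \<ge> card P * S + card A\<close>, the ratio of copies to
  points grows by at least \<open>1 / card P\<close> in each round. Multiplying the bound by
  \<open>card P\<close> avoids the exponent \<open>m - 1\<close>, which would be truncated at
  \<open>m = 0\<close>.\<close>

lemma parallelogram_free_many_copies:
  assumes P: "parallelogram_free P" and k: "card P \<ge> 2"
  shows "\<exists>A. parallelogram_free A \<and> card A = card P ^ m \<and>
    m * card P ^ m \<le> card P * similar_copies P A"
proof (induction m)
  case 0
  have "parallelogram_free {0}" by (auto simp: parallelogram_free_iff)
  then show ?case by (intro exI[of _ "{0}"]) auto
next
  case (Suc m)
  then obtain A where A: "parallelogram_free A" "card A = card P ^ m"
    "m * card P ^ m \<le> card P * similar_copies P A" by blast
  have fin: "finite P" "finite A" using P A by (auto simp: parallelogram_free_def)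
  obtain z w where zw: "\<And>p. p \<in> P \<Longrightarrow> 1 + p * z \<noteq> 0" "\<And>a. a \<in> A \<Longrightarrow> z * a + w \<noteq> 0"
    "inj_on (\<lambda>(p, a). spread z w p a) (P \<times> A)"
    "parallelogram_free ((\<lambda>(p, a). spread z w p a) ` (P \<times> A))"
    using spread_generic[OF P A(1)] by blast
  let ?B = "(\<lambda>(p, a). spread z w p a) ` (P \<times> A)"
  have "card ?B = card P ^ Suc m"
    using card_image[OF zw(3)] A(2) by (simp add: card_cartesian_product)
  moreover have "Suc m * card P ^ Suc m \<le> card P * similar_copies P ?B"
  proof -
    have "Suc m * card P ^ Suc m = card P * (m * card P ^ m + card A)"
      using A(2) by (simp add: algebra_simps)
    also have "\<dots> \<le> card P * (card P * similar_copies P A + card A)"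
      using A(3) by (intro mult_left_mono add_mono) auto
    also have "\<dots> \<le> card P * similar_copies P ?B"
      using similar_copies_spread[OF fin k zw(1-3)] by (intro mult_left_mono) auto
    finally show ?thesis .
  qed
  ultimately show ?case using zw(4) by blast
qed

theorem theorem10:
  fixes P :: "complex set"
  assumes "parallelogram_free P" and "card P \<ge> 3"
  shows "\<exists>c::real. c > 0 \<and>
    (\<forall>n::nat. n \<ge> card P \<longrightarrow> real (max_similar_copies_pf P n) \<ge> c * real n * ln (real n))"
proof -
  define k where "k = card P"
  have k: "k \<ge> 3" using assms k_def by simp
  \<comment> \<open>One factor \<open>k\<close> pays for rounding \<open>n\<close> down to a power
    of \<open>k\<close>, the other for the factor \<open>k\<close> in the bound on copies; the 2
    comes from \<open>m + 1 \<le> 2 * m\<close>, and \<open>ln k\<close> from the change of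
    base.\<close>
  define c where "c = 1 / (2 * real k ^ 2 * ln (real k))"
  have lnk: "ln (real k) > 0" using k by simp
  have "c * real n * ln (real n) \<le> real (max_similar_copies_pf P n)" if n: "n \<ge> k" for n
  proof -
    obtain m where m: "k ^ m \<le> n" "n < k ^ (m + 1)"
      using ex_power_ivl1[of k n] k n by auto
    \<comment> \<open>Here \<open>n \<ge> k\<close> enters; the estimate
      \<open>m + 1 \<le> 2 * m\<close> fails for \<open>m = 0\<close>.\<close>
    have m1: "m \<ge> 1"
    proof (rule ccontr)
      assume "\<not> m \<ge> 1"
      then have "m = 0" by simp
      with m n show False by simp
    qed
    obtain A where A: "parallelogram_free A" "card A = k ^ m" "m * k ^ m \<le> k * similar_copies P A"
      using parallelogram_free_many_copies[OF assms(1), of m] k unfolding k_def by auto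
    obtain B where B: "A \<subseteq> B" "parallelogram_free B" "card B = n"
      using parallelogram_free_extend[OF A(1), of n] A(2) m(1) by auto
    have "finite B" using B by (simp add: parallelogram_free_def)
    then have S: "similar_copies P A \<le> max_similar_copies_pf P n" (is "_ \<le> ?M")
      using similar_copies_mono[OF B(1)] max_similar_copies_pf_ge[OF B(2,3)] le_trans by blast
    have "m * k ^ m \<le> k * ?M" using A(3) S by (meson le_trans mult_le_mono2)
    then have M: "real m * real k ^ m \<le> real k * real ?M"
      by (metis of_nat_le_iff of_nat_mult of_nat_power)
    have nk: "real n \<le> real k ^ (m + 1)"
      using m(2) by (metis less_imp_le of_nat_le_iff of_nat_power)
    have n0: "real n > 0" using n k by simp
    have "ln (real n) \<le> ln (real k ^ (m + 1))" using nk n0 by (subst ln_le_cancel_iff) auto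
    also have "\<dots> = real (m + 1) * ln (real k)" using k by (subst ln_realpow) auto
    also have "\<dots> \<le> 2 * real m * ln (real k)" using m1 lnk by (intro mult_right_mono) auto
    finally have ln: "ln (real n) \<le> 2 * real m * ln (real k)" .
    have "real n * ln (real n) \<le> real k ^ (m + 1) * (2 * real m * ln (real k))"
      using nk ln n k by (intro mult_mono) auto
    also have "\<dots> = 2 * real k * ln (real k) * (real m * real k ^ m)" by simp
    also have "\<dots> \<le> 2 * real k * ln (real k) * (real k * real ?M)"
      using M lnk by (intro mult_left_mono) auto
    also have "\<dots> = (2 * real k ^ 2 * ln (real k)) * real ?M"
      by (simp add: power2_eq_square)
    finally show ?thesis
      using k lnk unfolding c_def by (simp add: field_simps)
  qed
  moreover have "c > 0" using k lnk by (simp add: c_def)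
  ultimately show ?thesis unfolding k_def by blast
qed

end
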